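(* Suppose $\mathcal{C}(x_0)\neq\varnothing$. If $c\in\mathcal{C}(x_0)$, then $t_*=t_*(x_0,c)$ is the lifespan of the characteristic $L_c(x_0)$ in the following sense: (i) If $t_*<\infty$, then for any $(x,t)\in L_c(x_0)$: $\mathcal{U}(x,t)=\{c\}$ if $t<t_*$; $\{c\}\subset\mathcal{U}(x_*,t_* )$ if $t=t_*$, where $x_*:=x_0+t_*f'(c)$; and $c\notin\mathcal{U}(x,t)$ if $t>t_*$. (ii) If $t_*=\infty$, then $\mathcal{U}(x,t)=\{c\}$ for any $(x,t)\in L_c(x_0)$ with $t>0$.
   Context: Setting: $f\in C^2(\mathbb{R})$, $f''\ge0$, $\mathcal{L}\{f''=0\}=0$ (Lebesgue measure), so $f'$ is strictly increasing; $\varphi\in L^\infty(\mathbb{R})$. For $t>0$: $E(u;x,t)=t\int_0^u f''(s)(\varphi(x-tf'(s))-s)\,ds$, and $\mathcal{U}(x,t)$ is the (nonempty compact) set of maximizers of $E(\cdot\,;x,t)$ over $\mathbb{R}$. $L_c(x_0)=\{(x,t): x=x_0+tf'(c),\ t>0\}$; $\mathcal{C}(x_0)=\{c\in\mathbb{R}: c\in\mathcal{U}(x,t)\text{ for some }(x,t)\in L_c(x_0)\}$. For $c\in\mathcal{C}(x_0)$: $t_*(x_0,c)=\sup\{t>0: c\in\mathcal{U}(x,t)\text{ for }(x,t)\in L_c(x_0)\}\in(0,\infty]$ (here $(x,t)$ is the point $(x_0+tf'(c),t)$). *)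

theory Defs
  imports "HOL-Analysis.Analysis"
begin

definition C2 :: "(real \<Rightarrow> real) \<Rightarrow> bool" where
  "C2 f \<longleftrightarrow> (\<forall>s. f field_differentiable (at s)) \<and>
     (\<forall>s. deriv f field_differentiable (at s)) \<and>
     continuous_on UNIV (deriv (deriv f))"

text \<open>Membership in $L^\infty$ is a property of a representative function; measurability is
  with respect to the completed measure.\<close>

definition L_infinity :: "(real \<Rightarrow> real) \<Rightarrow> bool" where
  "L_infinity \<phi> \<longleftrightarrow> \<phi> \<in> borel_measurable lebesgue \<and> (\<exists>M. AE y in lebesgue. \<bar>\<phi> y\<bar> \<le> M)"

text \<open>The integral is the oriented one: for \<open>u < 0\<close> it is minus the integral over \<open>(u, 0)\<close>.
  It is taken over \<open>lebesgue\<close> and not \<open>lborel\<close>, because the integrand need not be Borel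
  measurable, and a Bochner integral of a non-measurable function is 0 by convention.\<close>

definition E :: "(real \<Rightarrow> real) \<Rightarrow> (real \<Rightarrow> real) \<Rightarrow> real \<Rightarrow> real \<Rightarrow> real \<Rightarrow> real" where
  "E f \<phi> u x t = t * interval_lebesgue_integral lebesgue (ereal 0) (ereal u)
     (\<lambda>s. deriv (deriv f) s * (\<phi> (x - t * deriv f s) - s))"

definition maximizers :: "(real \<Rightarrow> real) \<Rightarrow> (real \<Rightarrow> real) \<Rightarrow> real \<Rightarrow> real \<Rightarrow> real set" where
  "maximizers f \<phi> x t = {u. \<forall>v. E f \<phi> v x t \<le> E f \<phi> u x t}"

definition characteristic :: "(real \<Rightarrow> real) \<Rightarrow> real \<Rightarrow> real \<Rightarrow> (real \<times> real) set" where
  "characteristic f c x0 = {(x, t). x = x0 + t * deriv f c \<and> t > 0}"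

definition char_speeds :: "(real \<Rightarrow> real) \<Rightarrow> (real \<Rightarrow> real) \<Rightarrow> real \<Rightarrow> real set" where
  "char_speeds f \<phi> x0 = {c. \<exists>(x, t) \<in> characteristic f c x0. c \<in> maximizers f \<phi> x t}"

definition t_star :: "(real \<Rightarrow> real) \<Rightarrow> (real \<Rightarrow> real) \<Rightarrow> real \<Rightarrow> real \<Rightarrow> ereal" where
  "t_star f \<phi> x0 c =
     Sup {ereal t | x t. (x, t) \<in> characteristic f c x0 \<and> c \<in> maximizers f \<phi> x t}"

end

theory Submission
  imports Defs
begin

text \<open>
  Substituting \<open>y = x - t f'(s)\<close> in the part of \<open>E\<close> containing \<open>\<phi>\<close> gives
  \<open>E(u) = \<Phi>(x - t f'(0)) - \<Phi>(x - t f'(u)) - t (W(u) - W(0))\<close>, where \<open>\<Phi>\<close> is a primitive of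
  \<open>\<phi>\<close> and \<open>W(u) = u f'(u) - f(u)\<close>. Suppose that \<open>c\<close> is a maximizer at time \<open>T\<close> on the
  characteristic and let \<open>t < T\<close>. For a competitor \<open>v\<close> at time \<open>t\<close> choose \<open>v'\<close> with
  \<open>T (f'(v') - f'(c)) = t (f'(v) - f'(c))\<close>: then \<open>v\<close> at time \<open>t\<close> and \<open>v'\<close> at time \<open>T\<close> see the same
  value of \<open>\<Phi>\<close>, and what is left is a combination of Bregman distances of \<open>f\<close>, which is positive
  for \<open>v \<noteq> c\<close>. So \<open>c\<close> is the only maximizer at all earlier times. At \<open>t\<^sub>*\<close> itself
  it is one because \<open>\<Phi>\<close> is continuous.
\<close>

section \<open>Primitives and the integrals behind \<open>E\<close>\<close>

definition primitive :: "(real \<Rightarrow> real) \<Rightarrow> real \<Rightarrow> real" where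
  "primitive h y = integral {0..y} h - integral {y..0} h"

lemma primitive_diff:
  fixes h :: "real \<Rightarrow> real"
  assumes h: "\<And>a b. h integrable_on {a..b}" and "a \<le> b"
  shows "primitive h b - primitive h a = integral {a..b} h"
proof -
  have comb: "integral {p..q} h + integral {q..r} h = integral {p..r} h"
    if "p \<le> q" "q \<le> r" for p q r
    using Henstock_Kurzweil_Integration.integral_combine[OF that h] .
  \<comment> \<open>With reversed endpoints the interval is empty or a point, so at most one of the
    two integrals in \<open>primitive\<close> survives: it is the oriented integral from 0 to
    \<open>y\<close>.\<close>
  have degenerate: "integral {p..q} h = 0" if "q \<le> p" for p q
    using that by (cases "p = q") simp_all
  consider "0 \<le> a" | "a \<le> 0" "0 \<le> b" | "b \<le> 0" by linarith
  then show ?thesis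
  proof cases
    case 1
    then show ?thesis
      using comb[of 0 a b] \<open>a \<le> b\<close> by (simp add: primitive_def degenerate)
  next
    case 2
    then show ?thesis
      using comb[of a 0 b] by (simp add: primitive_def degenerate)
  next
    case 3
    then show ?thesis
      using comb[of a b 0] \<open>a \<le> b\<close> by (simp add: primitive_def degenerate)
  qed
qed

lemma continuous_on_primitive:
  fixes h :: "real \<Rightarrow> real"
  assumes h: "\<And>a b. h integrable_on {a..b}"
  shows "continuous_on UNIV (primitive h)"
proof -
  have "isCont (primitive h) y" for y
  proof -
    have "continuous_on {y-1..y+1} (\<lambda>z. primitive h (y-1) + integral {y-1..z} h)"
      by (intro continuous_intros indefinite_integral_continuous_1 h)
    then have "continuous_on {y-1..y+1} (primitive h)"
    proof (rule continuous_on_eq)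
      fix z assume "z \<in> {y-1..y+1}"
      then show "primitive h (y-1) + integral {y-1..z} h = primitive h z"
        using primitive_diff[OF h, of "y-1" z] by simp
    qed
    then show ?thesis
      by (rule continuous_on_interior) simp
  qed
  then show ?thesis
    by (simp add: continuous_on_eq_continuous_at)
qed

lemma L_infinity_absolutely_integrable:
  assumes "L_infinity \<phi>"
  shows "\<phi> absolutely_integrable_on {a..b}"
proof -
  obtain M where \<phi>: "\<phi> \<in> borel_measurable lebesgue" and M: "AE y in lebesgue. \<bar>\<phi> y\<bar> \<le> M"
    using assms by (auto simp: L_infinity_def)
  show ?thesis
    unfolding set_integrable_def
  proof (rule integrableI_bounded_set_indicator[where B = M])
    show "AE y in lebesgue. y \<in> {a..b} \<longrightarrow> norm (\<phi> y) \<le> M"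
      using M by eventually_elim simp
  qed (use \<phi> in \<open>auto simp: emeasure_lborel_Icc_eq\<close>)
qed

text \<open>The left side is defined through open intervals. Endpoints do not affect the integral,
  and absolute integrability identifies the Lebesgue with the gauge integral.\<close>

lemma interval_lebesgue_integral_eq_integral:
  fixes h :: "real \<Rightarrow> real"
  assumes "\<And>p q. h absolutely_integrable_on {p..q}"
  shows "interval_lebesgue_integral lebesgue (ereal a) (ereal b) h =
    (if a \<le> b then integral {a..b} h else - integral {b..a} h)"
proof -
  have "(LINT s:{p<..<q}|lebesgue. h s) = integral {p..q} h" for p q :: real
  proof -
    have "h absolutely_integrable_on {p<..<q}"
      by (rule set_integrable_subset[OF assms[of p q]]) auto
    then show ?thesis
      by (simp add: set_lebesgue_integral_eq_integral integral_open_interval_real)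
  qed
  then show ?thesis
    by (simp add: interval_lebesgue_integral_def)
qed

section \<open>Strict convexity of \<open>f\<close>\<close>

lemma C2_DERIV:
  assumes "C2 f"
  shows "(f has_real_derivative deriv f s) (at s)"
    and "(deriv f has_real_derivative deriv (deriv f) s) (at s)"
  using assms by (auto simp: C2_def DERIV_deriv_iff_field_differentiable)

text \<open>If the nondecreasing \<open>deriv f\<close> took equal values at \<open>p < q\<close>,
  it would be constant in between, and the null set of zeros of the second derivative would contain
  an interval of positive length.\<close>

lemma strict_mono_deriv:
  assumes f: "C2 f" and nonneg: "\<forall>s. deriv (deriv f) s \<ge> 0"
    and null: "{s. deriv (deriv f) s = 0} \<in> null_sets lebesgue"
  shows "strict_mono (deriv f)"
proof (rule strict_monoI)
  have le: "deriv f p \<le> deriv f q" if "p \<le> q" for p q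
    using DERIV_nonneg_imp_nondecreasing[OF that] C2_DERIV(2)[OF f] nonneg by blast
  fix p q :: real
  assume "p < q"
  show "deriv f p < deriv f q"
  proof (rule ccontr)
    assume "\<not> deriv f p < deriv f q"
    then have const: "deriv f s = deriv f p" if "s \<in> {p<..<q}" for s
      using le[of p s] le[of s q] that by auto
    have "{p<..<q} \<subseteq> {s. deriv (deriv f) s = 0}"
    proof
      fix s assume s: "s \<in> {p<..<q}"
      have "(deriv f has_real_derivative 0) (at s)"
        by (rule has_field_derivative_transform_within_open[OF DERIV_const[of "deriv f p"], where S = "{p<..<q}"])
          (use s const in auto)
      then show "s \<in> {s. deriv (deriv f) s = 0}"
        by (simp add: DERIV_imp_deriv)
    qed
    then have "{p<..<q} \<in> null_sets lebesgue"
      using null null_sets_subset[of _ lebesgue] by (meson lmeasurable_box null_sets_completion_subset)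
    then show False
      using \<open>p < q\<close> by (simp add: null_sets_def)
  qed
qed

text \<open>By the mean value theorem the Bregman distance equals
  \<open>(x - y) * (f' z - f' y)\<close> with \<open>z\<close> strictly between \<open>x\<close> and
  \<open>y\<close>, so both factors have the same sign.\<close>

lemma bregman_pos:
  fixes f :: "real \<Rightarrow> real"
  assumes f: "\<And>s. (f has_real_derivative f' s) (at s)" and mono: "strict_mono f'"
    and "x \<noteq> y"
  shows "f x - f y - f' y * (x - y) > 0"
proof (cases "x < y")
  case True
  then obtain z where z: "x < z" "z < y" "f y - f x = (y - x) * f' z"
    using MVT2[OF True f] by auto
  have "0 < (y - x) * (f' y - f' z)"
    using z strict_monoD[OF mono, of z y] by simp
  then show ?thesis
    using z by (simp add: algebra_simps)
next
  case False
  then have "y < x" using assms(3) by simp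
  then obtain z where z: "y < z" "z < x" "f x - f y = (x - y) * f' z"
    using MVT2[OF \<open>y < x\<close> f] by auto
  have "0 < (x - y) * (f' z - f' y)"
    using z strict_monoD[OF mono, of y z] by simp
  then show ?thesis
    using z by (simp add: algebra_simps)
qed

section \<open>Closed form of \<open>E\<close>\<close>

lemma integrand_integral:
  fixes f \<phi> :: "real \<Rightarrow> real" and x t p q :: real
  assumes f: "C2 f" and nonneg: "\<forall>s. deriv (deriv f) s \<ge> 0" and mono: "strict_mono (deriv f)"
    and \<phi>: "L_infinity \<phi>" and "t > 0" and "p \<le> q"
  defines "h \<equiv> \<lambda>s. deriv (deriv f) s * (\<phi> (x - t * deriv f s) - s)"
  shows "h absolutely_integrable_on {p..q}"
    and "t * integral {p..q} h =
      primitive \<phi> (x - t * deriv f p) - primitive \<phi> (x - t * deriv f q)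
      - t * ((q * deriv f q - f q) - (p * deriv f p - f p))"
proof -
  note der = C2_DERIV[OF f]
  define g where "g = (\<lambda>s. x - t * deriv f s)"
  have g': "(g has_real_derivative - (t * deriv (deriv f) s)) (at s within S)" for s S
    unfolding g_def by (auto intro!: derivative_eq_intros DERIV_subset[OF der(2)])
  have g_less: "g b < g a" if "a < b" for a b
    using strict_monoD[OF mono that] \<open>t > 0\<close> by (simp add: g_def)
  have g_le: "g b \<le> g a" if "a \<le> b" for a b
    using g_less[of a b] that by (cases "a = b") auto
  \<comment> \<open>The derivative of \<open>g\<close> may have zeros; the change of variables
    relies on injectivity instead, which strict monotonicity provides.\<close>
  have inj: "inj_on g {p..q}"
    using g_less by (metis inj_onI less_irrefl linorder_neqE)
  have "continuous_on {p..q} g"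
    by (rule DERIV_continuous_on[OF g'])
  then have "{g q..g p} \<subseteq> g ` {p..q}"
    using IVT2'[of g q _ p] \<open>p \<le> q\<close> by fastforce
  then have image: "g ` {p..q} = {g q..g p}"
    using g_le by auto
  have abs_int: "\<phi> absolutely_integrable_on {a..b}" for a b
    by (rule L_infinity_absolutely_integrable[OF \<phi>])
  then have int: "\<phi> integrable_on {a..b}" for a b
    using set_lebesgue_integral_eq_integral(1) by blast
  \<comment> \<open>As \<open>g\<close> decreases, the image interval has swapped endpoints and the
    Jacobian is an absolute value. The formula also yields integrability of the product, so
    \<open>\<phi> (g s)\<close> needs no measurability argument of its own.\<close>
  have "(\<lambda>s. \<bar>- (t * deriv (deriv f) s)\<bar> * \<phi> (g s)) absolutely_integrable_on {p..q} \<and>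
      integral {p..q} (\<lambda>s. \<bar>- (t * deriv (deriv f) s)\<bar> * \<phi> (g s)) = integral {g q..g p} \<phi>"
    using has_absolute_integral_change_of_variables_1'[OF _ g' inj,
        where b = "integral {g q..g p} \<phi>" and f = \<phi>]
      abs_int image by simp
  moreover have "\<bar>- (t * deriv (deriv f) s)\<bar> = t * deriv (deriv f) s" for s
    using \<open>t > 0\<close> nonneg by simp
  ultimately have "(\<lambda>s. t * (deriv (deriv f) s * \<phi> (g s))) absolutely_integrable_on {p..q}"
    and "integral {p..q} (\<lambda>s. t * (deriv (deriv f) s * \<phi> (g s))) = integral {g q..g p} \<phi>"
    by (simp_all add: mult.assoc)
  then have \<phi>_part: "(\<lambda>s. deriv (deriv f) s * \<phi> (g s)) absolutely_integrable_on {p..q}"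
    and \<phi>_val: "t * integral {p..q} (\<lambda>s. deriv (deriv f) s * \<phi> (g s)) = integral {g q..g p} \<phi>"
    using \<open>t > 0\<close> by simp_all
  have "continuous_on {p..q} (deriv (deriv f))"
    using f continuous_on_subset by (auto simp: C2_def)
  then have id_part: "(\<lambda>s. deriv (deriv f) s * s) absolutely_integrable_on {p..q}"
    by (intro absolutely_integrable_continuous_real continuous_intros)
  \<comment> \<open>The antiderivative \<open>s * deriv f s - f s\<close> is the convex conjugate of
    \<open>f\<close> at the slope \<open>deriv f s\<close>.\<close>
  have "((\<lambda>s. deriv (deriv f) s * s) has_integral
      (q * deriv f q - f q) - (p * deriv f p - f p)) {p..q}"
  proof (rule fundamental_theorem_of_calculus[OF \<open>p \<le> q\<close>])
    fix s
    have "((\<lambda>s. s * deriv f s - f s) has_real_derivative deriv (deriv f) s * s) (at s)"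
      by (auto intro!: derivative_eq_intros der)
    then show "((\<lambda>s. s * deriv f s - f s) has_vector_derivative deriv (deriv f) s * s)
        (at s within {p..q})"
      using has_real_derivative_iff_has_vector_derivative DERIV_subset by blast
  qed
  then have id_val: "integral {p..q} (\<lambda>s. deriv (deriv f) s * s) =
      (q * deriv f q - f q) - (p * deriv f p - f p)"
    by (rule integral_unique)
  have h: "h = (\<lambda>s. deriv (deriv f) s * \<phi> (g s) - deriv (deriv f) s * s)"
    by (simp add: h_def g_def algebra_simps)
  show "h absolutely_integrable_on {p..q}"
    unfolding h by (rule set_integral_diff(1)[OF \<phi>_part id_part])
  have "integral {p..q} h = integral {p..q} (\<lambda>s. deriv (deriv f) s * \<phi> (g s)) -
      integral {p..q} (\<lambda>s. deriv (deriv f) s * s)"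
    unfolding h using \<phi>_part id_part
    by (intro Henstock_Kurzweil_Integration.integral_diff set_lebesgue_integral_eq_integral(1))
  then show "t * integral {p..q} h =
      primitive \<phi> (x - t * deriv f p) - primitive \<phi> (x - t * deriv f q)
      - t * ((q * deriv f q - f q) - (p * deriv f p - f p))"
    using \<phi>_val id_val primitive_diff[OF int g_le[OF \<open>p \<le> q\<close>]]
    by (simp add: g_def right_diff_distrib)
qed

text \<open>For \<open>u < 0\<close> the sign of the oriented integral undoes the exchange of
  endpoints, so one formula covers both signs of \<open>u\<close>.\<close>

lemma E_eq_primitive:
  assumes "C2 f" and "\<forall>s. deriv (deriv f) s \<ge> 0" and "strict_mono (deriv f)"
    and "L_infinity \<phi>" and "t > 0"
  shows "E f \<phi> u x t =
      primitive \<phi> (x - t * deriv f 0) - primitive \<phi> (x - t * deriv f u)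
      - t * ((u * deriv f u - f u) + f 0)"
proof -
  note int = integrand_integral[OF assms, of _ _ x]
  have "(\<lambda>s. deriv (deriv f) s * (\<phi> (x - t * deriv f s) - s)) absolutely_integrable_on {p..q}" for p q
    using int(1)[of p q] by (cases "p \<le> q") auto
  from interval_lebesgue_integral_eq_integral[OF this, of 0 u]
  show ?thesis
    using int(2)[of 0 u] int(2)[of u 0] by (auto simp: E_def algebra_simps)
qed

text \<open>Only two terms of the closed form depend on \<open>u\<close>, both with a minus sign;
  maximizing \<open>E\<close> thus becomes minimizing their sum.\<close>

lemma maximizers_iff:
  assumes "C2 f" and "\<forall>s. deriv (deriv f) s \<ge> 0" and "strict_mono (deriv f)"
    and "L_infinity \<phi>" and "t > 0"
  shows "u \<in> maximizers f \<phi> x t \<longleftrightarrow>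
    (\<forall>v. primitive \<phi> (x - t * deriv f u) + t * (u * deriv f u - f u)
       \<le> primitive \<phi> (x - t * deriv f v) + t * (v * deriv f v - f v))"
  unfolding maximizers_def mem_Collect_eq E_eq_primitive[OF assms]
  by (auto simp: algebra_simps)

section \<open>Maximizers along a characteristic\<close>

lemma maximizers_earlier:
  assumes f: "C2 f" and nonneg: "\<forall>s. deriv (deriv f) s \<ge> 0" and mono: "strict_mono (deriv f)"
    and \<phi>: "L_infinity \<phi>" and t: "0 < t" "t < T"
    and c: "c \<in> maximizers f \<phi> (x0 + T * deriv f c) T"
  shows "maximizers f \<phi> (x0 + t * deriv f c) t = {c}"
proof -
  let ?\<Phi> = "primitive \<phi>" and ?d = "deriv f"
  define W where "W u = u * ?d u - f u" for u
  have "0 < T" using t by simp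
  note iff = maximizers_iff[OF f nonneg mono \<phi>]
  have max_T: "?\<Phi> x0 + T * W c \<le> ?\<Phi> (x0 + T * ?d c - T * ?d v) + T * W v" for v
    using c[unfolded iff[OF \<open>0 < T\<close>]] by (simp add: W_def)
  have strict: "?\<Phi> x0 + t * W c < ?\<Phi> (x0 + t * ?d c - t * ?d v) + t * W v" if "v \<noteq> c" for v
  proof -
    \<comment> \<open>This is the matching condition solved for the slope at time \<open>T\<close>.
      Since \<open>0 < t / T < 1\<close>, \<open>w\<close> lies strictly between
      \<open>deriv f c\<close> and \<open>deriv f v\<close>; the intermediate value theorem gives
      \<open>z\<close>, and \<open>w \<noteq> deriv f v\<close> forces
      \<open>z \<noteq> v\<close>.\<close>
    define w where "w = ?d c + t / T * (?d v - ?d c)"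
    have cont: "continuous_on S ?d" for S
      by (intro continuous_at_imp_continuous_on ballI DERIV_isCont[OF C2_DERIV(2)[OF f]])
    have r: "0 < t / T" "t / T < 1" using t by auto
    have "\<exists>z. z \<noteq> v \<and> ?d z = w"
    proof (cases "c < v")
      case True
      then have "0 < ?d v - ?d c" using strict_monoD[OF mono True] by simp
      then have "0 < t / T * (?d v - ?d c)" "t / T * (?d v - ?d c) < 1 * (?d v - ?d c)"
        using r by (intro mult_pos_pos mult_strict_right_mono; simp)+
      then have "?d c \<le> w" "w < ?d v" by (auto simp: w_def)
      then show ?thesis
        using IVT'[of ?d c w v] True cont by (metis less_eq_real_def less_irrefl)
    next
      case False
      then have "v < c" using that by simp
      then have "0 < ?d c - ?d v" using strict_monoD[OF mono] by simp
      then have "0 < t / T * (?d c - ?d v)" "t / T * (?d c - ?d v) < 1 * (?d c - ?d v)"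
        using r by (intro mult_pos_pos mult_strict_right_mono; simp)+
      then have "w \<le> ?d c" "?d v < w" by (auto simp: w_def algebra_simps)
      then show ?thesis
        using IVT'[of ?d v w c] \<open>v < c\<close> cont by (metis less_eq_real_def less_irrefl)
    qed
    then obtain z where "z \<noteq> v" and z: "?d z = w" by blast
    have Tz: "T * (?d z - ?d c) = t * (?d v - ?d c)"
      using \<open>0 < T\<close> by (simp add: z w_def)
    note breg = bregman_pos[OF C2_DERIV(1)[OF f] mono]
    have "0 < t * (f z - f v - ?d v * (z - v))"
      using breg[OF \<open>z \<noteq> v\<close>] t by simp
    moreover have "0 \<le> (T - t) * (f z - f c - ?d c * (z - c))"
      using breg[of z c] t by (cases "z = c") auto
    \<comment> \<open>The identity holds for every \<open>z\<close>; its last summand vanishes by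
      \<open>Tz\<close>. The first Bregman term alone supplies strictness.\<close>
    moreover have "t * (W v - W c) - T * (W z - W c) =
        t * (f z - f v - ?d v * (z - v)) + (T - t) * (f z - f c - ?d c * (z - c))
        + z * (t * (?d v - ?d c) - T * (?d z - ?d c))"
      by (simp add: W_def algebra_simps)
    ultimately have "T * (W z - W c) < t * (W v - W c)"
      using Tz by simp
    moreover have "x0 + T * ?d c - T * ?d z = x0 + t * ?d c - t * ?d v"
      using Tz by (simp add: algebra_simps)
    then have "?\<Phi> x0 + T * W c \<le> ?\<Phi> (x0 + t * ?d c - t * ?d v) + T * W z"
      using max_T[of z] by (simp only:)
    ultimately show ?thesis
      by (simp add: right_diff_distrib)
  qed
  show ?thesis
  proof (intro equalityI subsetI)
    fix v assume "v \<in> maximizers f \<phi> (x0 + t * ?d c) t"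
    then have "?\<Phi> (x0 + t * ?d c - t * ?d v) + t * W v \<le> ?\<Phi> x0 + t * W c"
      unfolding iff[OF t(1)] by (auto simp: W_def dest: spec[where x = c])
    then show "v \<in> {c}" using strict[of v] by force
  next
    fix v assume "v \<in> {c}"
    moreover have "c \<in> maximizers f \<phi> (x0 + t * ?d c) t"
      unfolding iff[OF t(1)]
    proof
      fix v
      show "?\<Phi> (x0 + t * ?d c - t * ?d c) + t * (c * ?d c - f c)
          \<le> ?\<Phi> (x0 + t * ?d c - t * ?d v) + t * (v * ?d v - f v)"
        using strict[of v] by (cases "v = c") (simp_all add: W_def)
    qed
    ultimately show "v \<in> maximizers f \<phi> (x0 + t * ?d c) t" by simp
  qed
qed

text \<open>For a fixed competitor \<open>v\<close>, the minimality inequality compares two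
  functions continuous in time, so it survives the limit from the left. This settles the case where
  time equals the supremum.\<close>

lemma maximizers_closed:
  assumes f: "C2 f" and nonneg: "\<forall>s. deriv (deriv f) s \<ge> 0" and mono: "strict_mono (deriv f)"
    and \<phi>: "L_infinity \<phi>" and "0 < T"
    and max: "\<And>t. 0 < t \<Longrightarrow> t < T \<Longrightarrow> c \<in> maximizers f \<phi> (x0 + t * deriv f c) t"
  shows "c \<in> maximizers f \<phi> (x0 + T * deriv f c) T"
  unfolding maximizers_iff[OF f nonneg mono \<phi> \<open>0 < T\<close>]
proof
  fix v
  let ?F = "\<lambda>u t. primitive \<phi> (x0 + t * deriv f c - t * deriv f u) + t * (u * deriv f u - f u)"
  have "continuous_on UNIV (primitive \<phi>)"
    by (intro continuous_on_primitive set_lebesgue_integral_eq_integral(1)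
        L_infinity_absolutely_integrable \<phi>)
  then have "continuous_on UNIV (\<lambda>t. primitive \<phi> (x0 + t * deriv f c - t * deriv f u))" for u
    by (rule continuous_on_compose2) (auto intro!: continuous_intros)
  then have "continuous_on UNIV (?F u)" for u
    by (intro continuous_on_add continuous_on_mult continuous_on_id continuous_on_const)
  then have lim: "(?F u \<longlongrightarrow> ?F u T) (at_left T)" for u
    by (meson UNIV_I continuous_on_eq_continuous_at filterlim_at_split isCont_def open_UNIV)
  have "eventually (\<lambda>t. t \<in> {0<..<T}) (at_left T)"
    using eventually_at_left_real[OF \<open>0 < T\<close>] .
  then have "eventually (\<lambda>t. ?F c t \<le> ?F v t) (at_left T)"
  proof eventually_elim
    case (elim t)
    then show ?case
      using max[of t] maximizers_iff[OF f nonneg mono \<phi>, of t c] by simp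
  qed
  then show "?F c T \<le> ?F v T"
    by (rule tendsto_le[OF trivial_limit_at_left_real lim lim])
qed

section \<open>Finite and infinite lifespan\<close>

theorem theorem3p13:
  fixes f \<phi> :: "real \<Rightarrow> real" and x0 c :: real
  assumes "C2 f"
    and "\<forall>s. deriv (deriv f) s \<ge> 0"
    and "{s. deriv (deriv f) s = 0} \<in> null_sets lebesgue"
    and "L_infinity \<phi>"
    and "char_speeds f \<phi> x0 \<noteq> {}"
    and "c \<in> char_speeds f \<phi> x0"
  shows
    "(t_star f \<phi> x0 c < \<infinity> \<longrightarrow>
       (let ts = real_of_ereal (t_star f \<phi> x0 c); xs = x0 + ts * deriv f c in
        \<forall>(x, t) \<in> characteristic f c x0.
          (t < ts \<longrightarrow> maximizers f \<phi> x t = {c}) \<and>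
          (t = ts \<longrightarrow> {c} \<subseteq> maximizers f \<phi> xs ts) \<and>
          (t > ts \<longrightarrow> c \<notin> maximizers f \<phi> x t))) \<and>
     (t_star f \<phi> x0 c = \<infinity> \<longrightarrow>
       (\<forall>(x, t) \<in> characteristic f c x0. maximizers f \<phi> x t = {c}))"
proof -
  have mono: "strict_mono (deriv f)"
    using strict_mono_deriv assms(1-3) by blast
  note facts = assms(1,2) mono assms(4)
  define A where "A = {t. 0 < t \<and> c \<in> maximizers f \<phi> (x0 + t * deriv f c) t}"
  have ts: "t_star f \<phi> x0 c = Sup (ereal ` A)"
    unfolding t_star_def A_def characteristic_def by (rule arg_cong[of _ _ Sup]) auto
  \<comment> \<open>A time below the supremum lies below some \<open>T\<close> in \<open>A\<close>,
    from which uniqueness propagates back. If the supremum is infinite, this covers all positive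
    times.\<close>
  have earlier: "maximizers f \<phi> (x0 + t * deriv f c) t = {c}"
    if "0 < t" and less: "ereal t < t_star f \<phi> x0 c" for t
  proof -
    obtain T where "T \<in> A" "t < T"
      using less by (auto simp: ts less_Sup_iff)
    then show ?thesis
      using maximizers_earlier[OF facts \<open>0 < t\<close>] by (auto simp: A_def)
  qed
  have upper: "ereal t \<le> t_star f \<phi> x0 c" if "t \<in> A" for t
    using that by (auto simp: ts intro: Sup_upper)
  have fin: "(t < T \<longrightarrow> maximizers f \<phi> (x0 + t * deriv f c) t = {c}) \<and>
      (t = T \<longrightarrow> {c} \<subseteq> maximizers f \<phi> (x0 + T * deriv f c) T) \<and>
      (t > T \<longrightarrow> c \<notin> maximizers f \<phi> (x0 + t * deriv f c) t)"
    if T: "t_star f \<phi> x0 c = ereal T" and "0 < t" for t T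
  proof (intro conjI impI)
    assume "t < T"
    then show "maximizers f \<phi> (x0 + t * deriv f c) t = {c}"
      using earlier \<open>0 < t\<close> T by simp
  next
    assume "t = T"
    then show "{c} \<subseteq> maximizers f \<phi> (x0 + T * deriv f c) T"
      using maximizers_closed[OF facts, of T c x0] earlier \<open>0 < t\<close> T by simp
  next
    assume "T < t"
    then show "c \<notin> maximizers f \<phi> (x0 + t * deriv f c) t"
      using upper[of t] \<open>0 < t\<close> T by (auto simp: A_def)
  qed
  \<comment> \<open>The supremum of the empty set would be \<open>- \<infinity>\<close>, which also
    satisfies \<open>t_star f \<phi> x0 c < \<infinity>\<close>. An element of \<open>A\<close>
    excludes it, so \<open>real_of_ereal\<close> acts on a genuine real there.\<close>
  obtain t0 where "t0 \<in> A"
    using assms(6) by (auto simp: char_speeds_def characteristic_def A_def)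
  then have "t_star f \<phi> x0 c \<noteq> - \<infinity>"
    using upper[of t0] by auto
  then show ?thesis
    using fin earlier
    by (cases "t_star f \<phi> x0 c") (auto simp: Let_def characteristic_def)
qed

end
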